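(* Let $n=2$, let $q$ be a prime power and $\mathbb{V}_0=\mathbb{F}_q^2$. Then the map $\Phi:Aut(\mathbf{SIG}(\mathbb{V}_0))\to S_{\mathbb{P}^1(\mathbb{F}_q)}$, $\Phi(\varphi)=\varphi|_{\mathbb{P}^1(\mathbb{F}_q)}$, is a group epimorphism and $$\frac{Aut(\mathbf{SIG}(\mathbb{V}_0))}{\prod_{\mathcal{C}\in\mathcal{T}}S_{\mathcal{C}}}\cong S_{q+1},$$ where $\mathcal{T}$ is the set of all twin classes in the part $\mathcal{E}^1(\mathbb{F}_q)$.
   Context: $\mathbb{F}_q$ is the finite field with $q$ elements and $\mathbb{V}_0=\mathbb{F}_q^2$ is the space of column vectors. $E_2(\mathbb{F}_q)$ is the set of nonzero matrices $M\in M_2(\mathbb{F}_q)$ having at least one eigenvector in $\mathbb{V}_0$ (a nonzero $v$ with $Mv=\lambda v$ for some $\lambda\in\mathbb{F}_q$; $\lambda=0$ allowed). $\mathcal{E}^{1}(\mathbb{F}_q)=\{\langle M\rangle: M\in E_2(\mathbb{F}_q)\}$ is the set of one-dimensional subspaces of $M_2(\mathbb{F}_q)$ generated by elements of $E_2(\mathbb{F}_q)$, and $\mathbb{P}^{1}(\mathbb{F}_q)$ is the set of one-dimensional subspaces $\langle v\rangle$ of $\mathbb{V}_0$. The spectral incidence graph $\mathbf{SIG}(\mathbb{V}_0)$ is the simple bipartite graph with vertex set the disjoint union $\mathcal{E}^{1}(\mathbb{F}_q)\cup\mathbb{P}^{1}(\mathbb{F}_q)$ in which $\langle M\rangle$ and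 $\langle v\rangle$ are adjacent iff $v$ is an eigenvector of $M$. $N(x)$ is the set of neighbours of $x$; two vertices $x,y$ are twins if $N(x)=N(y)$, and the twin classes are the equivalence classes of this relation. $Aut$ of a graph is its group of graph automorphisms (permutations of the whole vertex set preserving adjacency in both directions). $S_X$ is the symmetric group on the set $X$ and $S_m$ the symmetric group on $\{1,\dots,m\}$. The group $\prod_{\mathcal{C}\in\mathcal{T}}S_{\mathcal{C}}$ is viewed as a subgroup of $Aut(\mathbf{SIG}(\mathbb{V}_0))$, each element permuting every $\mathcal{C}\in\mathcal{T}$ by its component and fixing every vertex of $\mathbb{P}^1(\mathbb{F}_q)$. *)

theory Defs
  imports
    "HOL-Algebra.Algebra"
    "HOL-Number_Theory.Prime_Powers"
    "Jordan_Normal_Form.Char_Poly"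
    "Graph_Theory.Pair_Digraph"
begin

section \<open>Automorphisms and twins of a graph\<close>

text \<open>Graphs are pair digraphs with a symmetric, irreflexive arc set (\<open>pair_graph\<close>).\<close>

definition Aut :: "'v pair_pre_digraph \<Rightarrow> ('v \<Rightarrow> 'v) monoid" where
  "Aut G = (BijGroup (pverts G))\<lparr>carrier :=
     {f \<in> Bij (pverts G). \<forall>x\<in>pverts G. \<forall>y\<in>pverts G. (f x, f y) \<in> parcs G \<longleftrightarrow> (x, y) \<in> parcs G}\<rparr>"

definition neighbours :: "'v pair_pre_digraph \<Rightarrow> 'v \<Rightarrow> 'v set" where
  "neighbours G x = {y \<in> pverts G. (x, y) \<in> parcs G}"

definition twin_rel :: "'v pair_pre_digraph \<Rightarrow> 'v rel" where
  "twin_rel G = {(x, y). x \<in> pverts G \<and> y \<in> pverts G \<and> neighbours G x = neighbours G y}"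

lemma equiv_twin_rel: "equiv (pverts G) (twin_rel G)"
  by (rule equivI) (auto simp: twin_rel_def refl_on_def sym_def trans_def)

definition twin_classes_in :: "'v pair_pre_digraph \<Rightarrow> 'v set \<Rightarrow> 'v set set" where
  "twin_classes_in G A = {C \<in> pverts G // twin_rel G. C \<subseteq> A}"

text \<open>
  A family of permutations of the twin classes contained in \<open>A\<close>, as a single permutation of the
  vertex set: it acts on each of these classes by the respective component of the family and
  fixes all other vertices.
\<close>

definition twin_perm :: "'v pair_pre_digraph \<Rightarrow> 'v set \<Rightarrow> ('v set \<Rightarrow> 'v \<Rightarrow> 'v) \<Rightarrow> 'v \<Rightarrow> 'v" where
  "twin_perm G A \<sigma> = (\<lambda>x\<in>pverts G.
     if twin_rel G `` {x} \<in> twin_classes_in G A then \<sigma> (twin_rel G `` {x}) x else x)"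


section \<open>The spectral incidence graph of the plane\<close>

definition is_eigenvector :: "'a::field mat \<Rightarrow> 'a vec \<Rightarrow> bool" where
  "is_eigenvector M v \<longleftrightarrow> (\<exists>k. eigenvector M v k)"

definition mat_line :: "'a::field mat \<Rightarrow> 'a mat set" where
  "mat_line M = range (\<lambda>c. c \<cdot>\<^sub>m M)"

definition vec_line :: "'a::field vec \<Rightarrow> 'a vec set" where
  "vec_line v = range (\<lambda>c. c \<cdot>\<^sub>v v)"

definition E2 :: "'a::field itself \<Rightarrow> 'a mat set" where
  "E2 _ = {M \<in> carrier_mat 2 2. M \<noteq> 0\<^sub>m 2 2 \<and> (\<exists>v \<in> carrier_vec 2. is_eigenvector M v)}"

definition E_lines :: "'a::field itself \<Rightarrow> 'a mat set set" where
  "E_lines _ = mat_line ` E2 TYPE('a)"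

definition P_lines :: "'a::field itself \<Rightarrow> 'a vec set set" where
  "P_lines _ = vec_line ` {v \<in> carrier_vec 2. v \<noteq> 0\<^sub>v 2}"

definition E_part :: "'a::field itself \<Rightarrow> ('a mat set + 'a vec set) set" where
  "E_part _ = Inl ` E_lines TYPE('a)"

definition P_part :: "'a::field itself \<Rightarrow> ('a mat set + 'a vec set) set" where
  "P_part _ = Inr ` P_lines TYPE('a)"

definition spectral_inc :: "'a::field itself \<Rightarrow> ('a mat set + 'a vec set) rel" where
  "spectral_inc _ = {(Inl (mat_line M), Inr (vec_line v)) | M v.
     M \<in> E2 TYPE('a) \<and> v \<in> carrier_vec 2 \<and> is_eigenvector M v}"

definition SIG :: "'a::field itself \<Rightarrow> ('a mat set + 'a vec set) pair_pre_digraph" where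
  "SIG _ = \<lparr>pverts = E_part TYPE('a) \<union> P_part TYPE('a),
            parcs = spectral_inc TYPE('a) \<union> (spectral_inc TYPE('a))\<inverse>\<rparr>"

text \<open>Adjacency in \<open>SIG\<close> does not depend on the chosen generators.\<close>

lemma is_eigenvector_smult:
  fixes M :: "'a::field mat"
  assumes M: "M \<in> carrier_mat 2 2" and v: "v \<in> carrier_vec 2" and "d \<noteq> 0"
    and ev: "is_eigenvector M v"
  shows "is_eigenvector (c \<cdot>\<^sub>m M) (d \<cdot>\<^sub>v v)"
proof -
  obtain k where k: "v \<noteq> 0\<^sub>v 2" "M *\<^sub>v v = k \<cdot>\<^sub>v v"
    using ev M by (auto simp: is_eigenvector_def eigenvector_def)
  have "d \<cdot>\<^sub>v v \<noteq> 0\<^sub>v 2"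
  proof
    assume "d \<cdot>\<^sub>v v = 0\<^sub>v 2"
    have "v = inverse d \<cdot>\<^sub>v (d \<cdot>\<^sub>v v)"
      using \<open>d \<noteq> 0\<close> by (simp add: smult_smult_assoc)
    also have "\<dots> = 0\<^sub>v 2" unfolding \<open>d \<cdot>\<^sub>v v = 0\<^sub>v 2\<close> by auto
    finally show False using k(1) by simp
  qed
  moreover have "(c \<cdot>\<^sub>m M) *\<^sub>v (d \<cdot>\<^sub>v v) = (c * k) \<cdot>\<^sub>v (d \<cdot>\<^sub>v v)"
  proof -
    have "(c \<cdot>\<^sub>m M) *\<^sub>v (d \<cdot>\<^sub>v v) = c \<cdot>\<^sub>v (M *\<^sub>v (d \<cdot>\<^sub>v v))"
      using M v by (intro eq_vecI) auto
    also have "M *\<^sub>v (d \<cdot>\<^sub>v v) = d \<cdot>\<^sub>v (k \<cdot>\<^sub>v v)"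
      using mult_mat_vec[OF M v, of d] k(2) by simp
    finally show ?thesis by (simp add: smult_smult_assoc ac_simps)
  qed
  ultimately have "eigenvector (c \<cdot>\<^sub>m M) (d \<cdot>\<^sub>v v) (c * k)"
    using M v by (simp add: eigenvector_def)
  then show ?thesis by (auto simp: is_eigenvector_def)
qed

lemma SIG_adjacent_iff:
  fixes M :: "'a::field mat"
  assumes M: "M \<in> E2 TYPE('a)" and v: "v \<in> carrier_vec 2" "v \<noteq> 0\<^sub>v 2"
  shows "(Inl (mat_line M), Inr (vec_line v)) \<in> parcs (SIG TYPE('a)) \<longleftrightarrow> is_eigenvector M v"
proof
  assume "is_eigenvector M v"
  then show "(Inl (mat_line M), Inr (vec_line v)) \<in> parcs (SIG TYPE('a))"
    using M v by (auto simp: SIG_def spectral_inc_def)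
next
  assume "(Inl (mat_line M), Inr (vec_line v)) \<in> parcs (SIG TYPE('a))"
  then obtain M' v' where *: "mat_line M = mat_line M'" "vec_line v = vec_line v'"
      "M' \<in> E2 TYPE('a)" "v' \<in> carrier_vec 2" "is_eigenvector M' v'"
    by (auto simp: SIG_def spectral_inc_def)
  have "M = 1 \<cdot>\<^sub>m M" by auto
  then have "M \<in> mat_line M" unfolding mat_line_def by blast
  then obtain c where c: "M = c \<cdot>\<^sub>m M'" unfolding *(1) by (auto simp: mat_line_def)
  have "v = 1 \<cdot>\<^sub>v v" by simp
  then have "v \<in> vec_line v" unfolding vec_line_def by blast
  then obtain d where d: "v = d \<cdot>\<^sub>v v'" unfolding *(2) by (auto simp: vec_line_def)
  have "d \<noteq> 0" using d v(2) *(4) by auto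
  then show "is_eigenvector M v"
    unfolding c d using is_eigenvector_smult[of M' v' d c] * by (auto simp: E2_def)
qed

lemma pair_graph_SIG: "pair_graph (SIG TYPE('a::{field,finite}))"
proof -
  have "carrier_mat 2 2 \<subseteq> (\<lambda>f. mat 2 2 f :: 'a mat) ` (\<Pi>\<^sub>E x\<in>{..<2} \<times> {..<2}. UNIV)"
  proof
    fix M :: "'a mat" assume "M \<in> carrier_mat 2 2"
    then have "M = mat 2 2 (restrict (\<lambda>x. M $$ x) ({..<2} \<times> {..<2}))" by (intro eq_matI) auto
    then show "M \<in> (\<lambda>f. mat 2 2 f) ` (\<Pi>\<^sub>E x\<in>{..<2} \<times> {..<2}. UNIV)"
      by (rule image_eqI[where f = "\<lambda>f. mat 2 2 f"]) (rule restrict_PiE_iff[THEN iffD2], simp)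
  qed
  then have "finite (carrier_mat 2 2 :: 'a mat set)"
    by (rule finite_subset) (simp add: finite_PiE)
  then have 1: "finite (E_part TYPE('a))"
    by (auto simp: E_part_def E_lines_def E2_def)
  have "carrier_vec 2 \<subseteq> (\<lambda>f. vec 2 f :: 'a vec) ` (\<Pi>\<^sub>E x\<in>{..<2}. UNIV)"
  proof
    fix v :: "'a vec" assume "v \<in> carrier_vec 2"
    then have "v = vec 2 (restrict (\<lambda>x. v $ x) {..<2})" by (intro eq_vecI) auto
    then show "v \<in> (\<lambda>f. vec 2 f) ` (\<Pi>\<^sub>E x\<in>{..<2}. UNIV)"
      by (rule image_eqI[where f = "\<lambda>f. vec 2 f"]) (rule restrict_PiE_iff[THEN iffD2], simp)
  qed
  then have "finite (carrier_vec 2 :: 'a vec set)"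
    by (rule finite_subset) (simp add: finite_PiE)
  then have 2: "finite (P_part TYPE('a))"
    by (auto simp: P_part_def P_lines_def)
  have 3: "spectral_inc TYPE('a) \<subseteq> E_part TYPE('a) \<times> P_part TYPE('a)"
  proof -
    have nz: "v \<noteq> 0\<^sub>v 2" if "M \<in> E2 TYPE('a)" "is_eigenvector M v" for M :: "'a mat" and v
      using that by (auto simp: E2_def is_eigenvector_def eigenvector_def)
    show ?thesis
      unfolding spectral_inc_def E_part_def P_part_def E_lines_def P_lines_def
      by (auto dest: nz)
  qed
  then have 4: "finite (spectral_inc TYPE('a))"
    by (rule finite_subset) (use 1 2 in simp)
  have 5: "pair_wf_digraph (SIG TYPE('a))"
    by unfold_locales (use 3 in \<open>force simp: SIG_def\<close>)+
  have 6: "finite (pverts (SIG TYPE('a)))" "finite (parcs (SIG TYPE('a)))"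
    using 1 2 4 by (simp_all add: SIG_def)
  have 7: "symmetric (with_proj (SIG TYPE('a)))"
    by (simp add: symmetric_def SIG_def sym_Un_converse)
  have 8: "fst e \<noteq> snd e" if "e \<in> parcs (SIG TYPE('a))" for e
    using that by (auto simp: SIG_def spectral_inc_def)
  show ?thesis
    using 5 6 7 8
    by (simp add: pair_graph_def pair_digraph_def pair_pseudo_graph_def pair_fin_digraph_def
        pair_sym_digraph_def pair_loopfree_digraph_def pair_fin_digraph_axioms_def
        pair_sym_digraph_axioms_def pair_loopfree_digraph_axioms_def)
qed

end

theory Submission
  imports Defs
begin

text \<open>
  The proof uses very little linear algebra. A matrix in \<open>E2\<close> has one eigenline, two eigenlines, or
  is scalar, in which case all lines are eigenlines (\<open>neighbours_SIG_cases\<close>); and the general linear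
  group, acting on matrices by conjugation, gives automorphisms of the graph which are
  doubly transitive on the points (\<open>Aut_SIG_two_transitive\<close>). The rest is an argument about bipartite
  graphs, carried out in the locale \<open>two_transitive_bipartite\<close>.

  Automorphisms preserve the set \<open>P\<close> of points (\<open>Aut_image_P\<close>), because the scalar vertex is adjacent
  to all of \<open>P\<close> and \<open>P\<close> is smaller than the other side. Hence restriction to \<open>P\<close> is a homomorphism. It
  is onto: given a permutation \<open>\<pi>\<close> of \<open>P\<close> and a neighbourhood \<open>S\<close> of a matrix vertex, that is, one point,
  two points or all of \<open>P\<close>, some automorphism maps \<open>S\<close> to \<open>\<pi> ` S\<close>, so it maps the twin class with
  neighbourhood \<open>S\<close> onto the one with neighbourhood \<open>\<pi> ` S\<close>; these bijections between twin classes
  combine to an automorphism that extends \<open>\<pi>\<close> (\<open>extend_to_Aut\<close>). Its kernel consists of the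
  automorphisms that preserve each neighbourhood of a matrix vertex, which are the families of
  permutations of the twin classes (\<open>twin_perm_image_eq_kernel\<close>). The quotient is then the symmetric
  group of \<open>P\<close> by the first isomorphism theorem, and \<open>P\<close> has \<open>q + 1\<close> elements.
\<close>

section \<open>Automorphism groups and permutations of twin classes\<close>

lemma carrier_BijGroup: "carrier (BijGroup S) = Bij S"
  by (simp add: BijGroup_def)

lemma mult_BijGroup: "f \<in> Bij S \<Longrightarrow> g \<in> Bij S \<Longrightarrow> f \<otimes>\<^bsub>BijGroup S\<^esub> g = compose S f g"
  by (simp add: BijGroup_def)

lemma Bij_mem: "f \<in> Bij S \<Longrightarrow> x \<in> S \<Longrightarrow> f x \<in> S"
  using Bij_imp_funcset by fastforce

lemma Bij_image: "f \<in> Bij S \<Longrightarrow> f ` S = S"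
  by (simp add: Bij_def bij_betw_def)

lemma Bij_inj_on: "f \<in> Bij S \<Longrightarrow> inj_on f S"
  by (simp add: Bij_def bij_betw_def)

lemma restrict_Bij: "f \<in> Bij V \<Longrightarrow> S \<subseteq> V \<Longrightarrow> f ` S = S \<Longrightarrow> restrict f S \<in> Bij S"
  by (auto simp: Bij_def bij_betw_def inj_on_restrict_eq intro: inj_on_subset)

lemma Bij_eqI: "f \<in> Bij S \<Longrightarrow> g \<in> Bij S \<Longrightarrow> (\<And>x. x \<in> S \<Longrightarrow> f x = g x) \<Longrightarrow> f = g"
  by (auto simp: Bij_def intro: extensionalityI)

lemma carrier_Aut:
  "f \<in> carrier (Aut G) \<longleftrightarrow> f \<in> Bij (pverts G) \<and>
     (\<forall>x\<in>pverts G. \<forall>y\<in>pverts G. (f x, f y) \<in> parcs G \<longleftrightarrow> (x, y) \<in> parcs G)"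
  by (simp add: Aut_def)

lemma mult_Aut:
  "f \<in> carrier (Aut G) \<Longrightarrow> g \<in> carrier (Aut G) \<Longrightarrow> f \<otimes>\<^bsub>Aut G\<^esub> g = compose (pverts G) f g"
  by (simp add: Aut_def BijGroup_def)

lemma Aut_mem: "f \<in> carrier (Aut G) \<Longrightarrow> x \<in> pverts G \<Longrightarrow> f x \<in> pverts G"
  by (simp add: carrier_Aut Bij_mem)

lemma subgroup_Aut: "subgroup (carrier (Aut G)) (BijGroup (pverts G))"
proof (rule group.subgroupI[OF group_BijGroup])
  show "carrier (Aut G) \<subseteq> carrier (BijGroup (pverts G))"
    by (auto simp: carrier_Aut carrier_BijGroup)
  have "(\<lambda>x\<in>pverts G. x) \<in> carrier (Aut G)"
    by (simp add: carrier_Aut id_Bij)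
  then show "carrier (Aut G) \<noteq> {}" by blast
  fix f assume f: "f \<in> carrier (Aut G)"
  then have fB: "f \<in> Bij (pverts G)" by (simp add: carrier_Aut)
  have mem: "inv_into (pverts G) f x \<in> pverts G" if "x \<in> pverts G" for x
    using Bij_inv_into_mem[OF fB that] .
  have inv: "f (inv_into (pverts G) f x) = x" if "x \<in> pverts G" for x
    using that Bij_image[OF fB] by (metis f_inv_into_f)
  show "inv\<^bsub>BijGroup (pverts G)\<^esub> f \<in> carrier (Aut G)"
    unfolding inv_BijGroup[OF fB] carrier_Aut
  proof (intro conjI ballI)
    show "restrict (inv_into (pverts G) f) (pverts G) \<in> Bij (pverts G)"
      using restrict_inv_into_Bij[OF fB] by simp
  next
    fix x y assume "x \<in> pverts G" "y \<in> pverts G"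
    then show "(restrict (inv_into (pverts G) f) (pverts G) x,
        restrict (inv_into (pverts G) f) (pverts G) y) \<in> parcs G \<longleftrightarrow> (x, y) \<in> parcs G"
      using f mem inv unfolding carrier_Aut by (metis restrict_apply')
  qed
  fix g assume g: "g \<in> carrier (Aut G)"
  show "f \<otimes>\<^bsub>BijGroup (pverts G)\<^esub> g \<in> carrier (Aut G)"
    using f g by (auto simp: carrier_Aut mult_BijGroup compose_Bij compose_eq Bij_mem)
qed

lemma group_Aut: "group (Aut G)"
  using subgroup.subgroup_is_group[OF subgroup_Aut group_BijGroup, of G]
  by (simp add: Aut_def)

lemma neighbours_Aut:
  assumes f: "f \<in> carrier (Aut G)" and x: "x \<in> pverts G"
  shows "neighbours G (f x) = f ` neighbours G x"
proof (intro equalityI subsetI)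
  fix y assume y: "y \<in> neighbours G (f x)"
  then have "y \<in> f ` pverts G"
    using f Bij_image by (auto simp: neighbours_def carrier_Aut)
  then show "y \<in> f ` neighbours G x"
    using f x y by (auto simp: neighbours_def carrier_Aut)
next
  fix y assume "y \<in> f ` neighbours G x"
  then show "y \<in> neighbours G (f x)"
    using f x Aut_mem[OF f] by (auto simp: neighbours_def carrier_Aut)
qed

text \<open>A twin class is determined by any of its members, so \<open>twin_perm\<close>, which looks up the class of
  its argument, acts on a class \<open>C\<close> simply as the component at \<open>C\<close>.\<close>

lemma twin_class_eq:
  assumes "C \<in> twin_classes_in G A" "x \<in> C"
  shows "twin_rel G `` {x} = C"
proof -
  obtain y where y: "y \<in> pverts G" "C = twin_rel G `` {y}"
    using assms(1) by (auto simp: twin_classes_in_def quotient_def)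
  then have "(y, x) \<in> twin_rel G" using assms(2) by simp
  then show ?thesis
    using equiv_class_eq[OF equiv_twin_rel] y(2) by metis
qed

lemma twin_classes_in_subset: "C \<in> twin_classes_in G A \<Longrightarrow> C \<subseteq> pverts G"
  by (auto simp: twin_classes_in_def quotient_def twin_rel_def)

lemma self_mem_twin_class: "x \<in> pverts G \<Longrightarrow> x \<in> twin_rel G `` {x}"
  by (simp add: twin_rel_def)

lemma twin_perm_inside:
  assumes "C \<in> twin_classes_in G A" "x \<in> C"
  shows "twin_perm G A \<sigma> x = \<sigma> C x"
  using assms twin_class_eq[OF assms] twin_classes_in_subset[OF assms(1)]
  by (auto simp: twin_perm_def)

lemma twin_perm_outside:
  assumes "x \<in> pverts G" "twin_rel G `` {x} \<notin> twin_classes_in G A"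
  shows "twin_perm G A \<sigma> x = x"
  using assms by (simp add: twin_perm_def)

text \<open>A permutation that moves each vertex to a twin changes no neighbourhood; in a symmetric
  graph this is enough to preserve all arcs, since either end of an arc may be moved alone.\<close>

lemma twins_in_Aut:
  assumes sym: "sym (parcs G)" and f: "f \<in> Bij (pverts G)"
    and twin: "\<And>x. x \<in> pverts G \<Longrightarrow> neighbours G (f x) = neighbours G x"
  shows "f \<in> carrier (Aut G)"
  unfolding carrier_Aut
proof (intro conjI f ballI)
  fix x y assume xy: "x \<in> pverts G" "y \<in> pverts G"
  have "(f x, f y) \<in> parcs G \<longleftrightarrow> (x, f y) \<in> parcs G"
    using twin[OF xy(1)] Bij_mem[OF f xy(2)] by (auto simp: neighbours_def)
  also have "\<dots> \<longleftrightarrow> (f y, x) \<in> parcs G"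
    using sym by (auto dest: symD)
  also have "\<dots> \<longleftrightarrow> (y, x) \<in> parcs G"
    using twin[OF xy(2)] xy(1) by (auto simp: neighbours_def)
  also have "\<dots> \<longleftrightarrow> (x, y) \<in> parcs G"
    using sym by (auto dest: symD)
  finally show "(f x, f y) \<in> parcs G \<longleftrightarrow> (x, y) \<in> parcs G" .
qed

lemma twin_perm_in_class:
  assumes \<sigma>: "\<sigma> \<in> carrier (product_group (twin_classes_in G A) BijGroup)" and x: "x \<in> pverts G"
  shows "twin_perm G A \<sigma> x \<in> twin_rel G `` {x}"
proof (cases "twin_rel G `` {x} \<in> twin_classes_in G A")
  case True
  then have "\<sigma> (twin_rel G `` {x}) \<in> Bij (twin_rel G `` {x})"
    using \<sigma> by (auto simp: carrier_BijGroup)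
  then show ?thesis
    using twin_perm_inside[OF True] self_mem_twin_class[OF x] Bij_mem by metis
next
  case False
  then show ?thesis using twin_perm_outside[OF x False] self_mem_twin_class[OF x] by simp
qed

lemma twin_perm_Bij:
  assumes \<sigma>: "\<sigma> \<in> carrier (product_group (twin_classes_in G A) BijGroup)"
  shows "twin_perm G A \<sigma> \<in> Bij (pverts G)"
proof -
  let ?f = "twin_perm G A \<sigma>" and ?c = "\<lambda>x. twin_rel G `` {x}"
  have in_class: "?f x \<in> ?c x" if "x \<in> pverts G" for x
    using twin_perm_in_class[OF \<sigma> that] .
  have same: "?c (?f x) = ?c x" if "x \<in> pverts G" for x
    using in_class[OF that] equiv_class_eq[OF equiv_twin_rel] by (metis Image_singleton_iff)
  have \<sigma>B: "\<sigma> C \<in> Bij C" if "C \<in> twin_classes_in G A" for C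
    using \<sigma> that by (auto simp: carrier_BijGroup)
  have "inj_on ?f (pverts G)"
  proof (rule inj_onI)
    fix x y assume xy: "x \<in> pverts G" "y \<in> pverts G" "?f x = ?f y"
    then have c: "?c x = ?c y" using same by metis
    show "x = y"
    proof (cases "?c x \<in> twin_classes_in G A")
      case True
      have "\<sigma> (?c x) x = \<sigma> (?c x) y"
        using xy c True twin_perm_inside[OF True] self_mem_twin_class by metis
      then show ?thesis
        using Bij_inj_on[OF \<sigma>B[OF True]] xy c self_mem_twin_class by (metis inj_onD)
    next
      case False
      then show ?thesis using xy c twin_perm_outside by metis
    qed
  qed
  moreover have "y \<in> ?f ` pverts G" if y: "y \<in> pverts G" for y
  proof (cases "?c y \<in> twin_classes_in G A")
    case True
    obtain x where "x \<in> ?c y" "\<sigma> (?c y) x = y"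
      using Bij_image[OF \<sigma>B[OF True]] self_mem_twin_class[OF y] by (metis imageE)
    then show ?thesis
      using twin_perm_inside[OF True] twin_classes_in_subset[OF True] by (metis image_eqI subsetD)
  next
    case False
    then show ?thesis using twin_perm_outside[OF y False] y by (metis image_eqI)
  qed
  moreover have "?f x \<in> pverts G" if "x \<in> pverts G" for x
    using in_class[OF that] by (simp add: twin_rel_def)
  ultimately have "bij_betw ?f (pverts G) (pverts G)"
    unfolding bij_betw_def by blast
  then show ?thesis by (simp add: Bij_def) (simp add: twin_perm_def)
qed

lemma twin_perm_Aut:
  assumes "sym (parcs G)" and \<sigma>: "\<sigma> \<in> carrier (product_group (twin_classes_in G A) BijGroup)"
  shows "twin_perm G A \<sigma> \<in> carrier (Aut G)"
  using assms(1) twin_perm_Bij[OF \<sigma>]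
proof (rule twins_in_Aut)
  fix x assume "x \<in> pverts G"
  then show "neighbours G (twin_perm G A \<sigma> x) = neighbours G x"
    using twin_perm_in_class[OF \<sigma>] by (auto simp: twin_rel_def)
qed

lemma twin_perm_mon:
  assumes sym: "sym (parcs G)"
  shows "twin_perm G A \<in> mon (product_group (twin_classes_in G A) BijGroup) (Aut G)"
proof -
  let ?T = "twin_classes_in G A" and ?H = "product_group (twin_classes_in G A) BijGroup"
  have \<sigma>B: "\<sigma> C \<in> Bij C" if "\<sigma> \<in> carrier ?H" "C \<in> ?T" for \<sigma> C
    using that by (auto simp: carrier_BijGroup)
  have "twin_perm G A (\<sigma> \<otimes>\<^bsub>?H\<^esub> \<tau>) = twin_perm G A \<sigma> \<otimes>\<^bsub>Aut G\<^esub> twin_perm G A \<tau>"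
    if \<sigma>: "\<sigma> \<in> carrier ?H" and \<tau>: "\<tau> \<in> carrier ?H" for \<sigma> \<tau>
  proof -
    have "twin_perm G A (\<sigma> \<otimes>\<^bsub>?H\<^esub> \<tau>) x = twin_perm G A \<sigma> (twin_perm G A \<tau> x)"
      if x: "x \<in> pverts G" for x
    proof (cases "twin_rel G `` {x} \<in> ?T")
      case True
      define C where "C = twin_rel G `` {x}"
      have C: "C \<in> ?T" "x \<in> C" using True self_mem_twin_class[OF x] by (auto simp: C_def)
      then show ?thesis
        using Bij_mem[OF \<sigma>B[OF \<tau> C(1)] C(2)]
        by (simp add: twin_perm_inside mult_BijGroup \<sigma>B[OF \<sigma>] \<sigma>B[OF \<tau>] compose_eq
            del: carrier_product_group)
    next
      case False
      then show ?thesis using x by (simp add: twin_perm_outside)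
    qed
    then show ?thesis
      using \<sigma> \<tau>
      by (simp add: mult_Aut twin_perm_Aut[OF sym] del: carrier_product_group)
        (auto simp: fun_eq_iff compose_def twin_perm_def)
  qed
  then have "twin_perm G A \<in> hom ?H (Aut G)"
    by (auto simp: hom_def twin_perm_Aut[OF sym] simp del: carrier_product_group mult_product_group)
  moreover have "inj_on (twin_perm G A) (carrier ?H)"
  proof (rule inj_onI)
    fix \<sigma> \<tau> assume \<sigma>: "\<sigma> \<in> carrier ?H" and \<tau>: "\<tau> \<in> carrier ?H"
      and eq: "twin_perm G A \<sigma> = twin_perm G A \<tau>"
    have "\<sigma> C = \<tau> C" if C: "C \<in> ?T" for C
    proof (rule Bij_eqI[OF \<sigma>B[OF \<sigma> C] \<sigma>B[OF \<tau> C]])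
      fix x assume "x \<in> C"
      then show "\<sigma> C x = \<tau> C x" using twin_perm_inside[OF C] eq by metis
    qed
    then show "\<sigma> = \<tau>"
      using \<sigma> \<tau> by (auto intro: PiE_ext)
  qed
  ultimately show ?thesis by (simp add: mon_def)
qed

text \<open>The two groups encode permutations differently: outside the permuted set, \<open>BijGroup\<close> uses
  \<open>undefined\<close> and \<open>sym_group\<close> the identity. Transport along an enumeration of \<open>S\<close> therefore has to
  reset the values outside the set in both directions.\<close>

lemma BijGroup_iso_sym_group:
  assumes "finite S"
  shows "BijGroup S \<cong> sym_group (card S)"
proof -
  let ?I = "{1..card S}"
  obtain h where h: "bij_betw h ?I S"
    using assms by (metis card_atLeastAtMost diff_Suc_1 finite_atLeastAtMost finite_same_card_bij)
  define k where "k = inv_into ?I h"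
  have k: "bij_betw k S ?I" unfolding k_def using h by (rule bij_betw_inv_into)
  have kh: "k (h i) = i" if "i \<in> ?I" for i
    using h that by (simp add: k_def bij_betw_inv_into_left)
  have hk: "h (k x) = x" if "x \<in> S" for x
    using h that by (simp add: k_def bij_betw_inv_into_right)
  have hS: "h i \<in> S" if "i \<in> ?I" for i using h that by (rule bij_betw_apply)
  have kI: "k x \<in> ?I" if "x \<in> S" for x using k that by (rule bij_betw_apply)
  define \<Theta> where "\<Theta> f = (\<lambda>i. if i \<in> ?I then k (f (h i)) else i)" for f
  have "\<Theta> \<in> hom (BijGroup S) (sym_group (card S))"
  proof (rule homI)
    fix f assume "f \<in> carrier (BijGroup S)"
    then have f: "bij_betw f S S" by (simp add: carrier_BijGroup Bij_def)
    have "bij_betw (k \<circ> (f \<circ> h)) ?I ?I"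
      using h f k by (blast intro: bij_betw_trans)
    then have "bij_betw (\<Theta> f) ?I ?I"
      by (rule bij_betw_cong[THEN iffD1, rotated]) (simp add: \<Theta>_def)
    then show "\<Theta> f \<in> carrier (sym_group (card S))"
      unfolding sym_group_carrier by (rule bij_imp_permutes) (auto simp: \<Theta>_def)
  next
    fix f g assume "f \<in> carrier (BijGroup S)" "g \<in> carrier (BijGroup S)"
    then show "\<Theta> (f \<otimes>\<^bsub>BijGroup S\<^esub> g) = \<Theta> f \<otimes>\<^bsub>sym_group (card S)\<^esub> \<Theta> g"
      using kI hS hk by (auto simp: carrier_BijGroup mult_BijGroup sym_group_mult \<Theta>_def
          fun_eq_iff compose_def Bij_mem simp del: atLeastAtMost_iff)
  qed
  moreover have "bij_betw \<Theta> (Bij S) {p. p permutes ?I}"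
  proof (rule bij_betw_byWitness[where f' = "\<lambda>p. \<lambda>x\<in>S. h (p (k x))"])
    show "\<forall>f\<in>Bij S. (\<lambda>x\<in>S. h (\<Theta> f (k x))) = f"
    proof
      fix f assume f: "f \<in> Bij S"
      show "(\<lambda>x\<in>S. h (\<Theta> f (k x))) = f"
      proof (rule extensionalityI)
        fix x assume x: "x \<in> S"
        then show "(\<lambda>x\<in>S. h (\<Theta> f (k x))) x = f x"
          using kI[OF x] hk[OF x] hk[OF Bij_mem[OF f x]] by (simp add: \<Theta>_def)
      qed (use f in \<open>simp_all add: Bij_imp_extensional\<close>)
    qed
    show "\<forall>p\<in>{p. p permutes ?I}. \<Theta> (\<lambda>x\<in>S. h (p (k x))) = p"
      by (auto simp: \<Theta>_def fun_eq_iff kh hS permutes_not_in permutes_in_image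
          simp del: atLeastAtMost_iff)
    show "\<Theta> ` Bij S \<subseteq> {p. p permutes ?I}"
      using calculation by (auto simp: hom_def carrier_BijGroup sym_group_carrier)
    show "(\<lambda>p. \<lambda>x\<in>S. h (p (k x))) ` {p. p permutes ?I} \<subseteq> Bij S"
    proof (intro image_subsetI)
      fix p assume "p \<in> {p. p permutes ?I}"
      then have "bij_betw p ?I ?I" by (simp add: permutes_imp_bij)
      then have "bij_betw (h \<circ> (p \<circ> k)) S S"
        using h k by (blast intro: bij_betw_trans)
      then have "bij_betw (\<lambda>x\<in>S. h (p (k x))) S S"
        by (rule bij_betw_cong[THEN iffD1, rotated]) simp
      then show "(\<lambda>x\<in>S. h (p (k x))) \<in> Bij S" by (simp add: Bij_def)
    qed
  qed
  ultimately have "\<Theta> \<in> iso (BijGroup S) (sym_group (card S))"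
    by (simp add: iso_def carrier_BijGroup sym_group_def)
  then show ?thesis by (auto simp: is_iso_def)
qed

section \<open>Bipartite graphs with a doubly transitive side\<close>

text \<open>These axioms collect what the proof needs to know about the spectral incidence graph, with \<open>E\<close> the
  side of the matrices and \<open>P\<close> the side of the points. The hub \<open>u\<close> (the scalar matrices) and a leaf
  (a nilpotent matrix) tell the two sides apart.\<close>

locale two_transitive_bipartite =
  fixes G :: "'v pair_pre_digraph" and E P :: "'v set" and u :: 'v
  assumes fin: "finite (pverts G)"
    and sides: "pverts G = E \<union> P" "E \<inter> P = {}"
    and arcs: "parcs G \<subseteq> E \<times> P \<union> P \<times> E" "sym (parcs G)"
    and two_points: "\<exists>p\<in>P. \<exists>p'\<in>P. p \<noteq> p'"
    and hub: "u \<in> E" "neighbours G u = P"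
    and leaf: "\<exists>e\<in>E. \<exists>p\<in>P. neighbours G e = {p}"
    and neighbourhoods: "e \<in> E \<Longrightarrow> neighbours G e = P \<or> (\<exists>p\<in>P. \<exists>p'\<in>P. neighbours G e = {p, p'})"
    and two_transitive: "p \<in> P \<Longrightarrow> p' \<in> P \<Longrightarrow> p \<noteq> p' \<Longrightarrow> r \<in> P \<Longrightarrow> r' \<in> P \<Longrightarrow> r \<noteq> r' \<Longrightarrow>
      \<exists>g\<in>carrier (Aut G). g p = r \<and> g p' = r'"
begin

lemma neighbours_E: "e \<in> E \<Longrightarrow> neighbours G e \<subseteq> P"
  using arcs sides by (auto simp: neighbours_def)

lemma neighbours_P: "p \<in> P \<Longrightarrow> neighbours G p \<subseteq> E"
  using arcs sides by (auto simp: neighbours_def)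

lemma neighbours_E_nonempty: "e \<in> E \<Longrightarrow> neighbours G e \<noteq> {}"
  using neighbourhoods two_points by blast

lemma neighbours_sym: "y \<in> neighbours G x \<Longrightarrow> x \<in> pverts G \<Longrightarrow> x \<in> neighbours G y"
  using arcs(2) by (auto simp: neighbours_def dest: symD)

lemma E_verts: "e \<in> E \<Longrightarrow> e \<in> pverts G" and P_verts: "p \<in> P \<Longrightarrow> p \<in> pverts G"
  by (auto simp: sides)

lemma transitive:
  assumes "p \<in> P" "r \<in> P"
  shows "\<exists>g\<in>carrier (Aut G). g p = r"
proof -
  obtain p' r' where "p' \<in> P" "p' \<noteq> p" "r' \<in> P" "r' \<noteq> r"
    using two_points by metis
  then show ?thesis using two_transitive[of p p' r r'] assms by blast
qed

text \<open>An automorphism that carries \<open>p\<close> to \<open>r\<close> carries a leaf at \<open>p\<close> to a leaf at \<open>r\<close>. The image lies in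
  \<open>E\<close> because it is adjacent to a vertex of \<open>P\<close>.\<close>

lemma leaf_at:
  assumes r: "r \<in> P"
  shows "\<exists>e\<in>E. neighbours G e = {r}"
proof -
  obtain e p where e: "e \<in> E" "p \<in> P" "neighbours G e = {p}" using leaf by blast
  obtain g where g: "g \<in> carrier (Aut G)" "g p = r" using transitive[OF e(2) r] by blast
  have N: "neighbours G (g e) = {r}"
    using neighbours_Aut[OF g(1) E_verts[OF e(1)]] e(3) g(2) by simp
  have "g e \<in> neighbours G r"
    using neighbours_sym[of r "g e"] N Aut_mem[OF g(1) E_verts[OF e(1)]] by simp
  then show ?thesis using N neighbours_P[OF r] by blast
qed

text \<open>Leaves at distinct points are distinct, and the hub is not a leaf, so \<open>E\<close> has at least
  one element more than \<open>P\<close>.\<close>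

lemma card_P_less_card_E: "card P < card E"
proof -
  obtain l where l: "\<And>r. r \<in> P \<Longrightarrow> l r \<in> E \<and> neighbours G (l r) = {r}"
    using leaf_at by metis
  have "inj_on l P" using l by (metis inj_onI singleton_inject)
  moreover have "l ` P \<subset> E"
  proof -
    have "u \<notin> l ` P" using l hub(2) two_points by (metis imageE singletonD)
    then show ?thesis using l hub(1) by blast
  qed
  moreover have "finite E" using fin sides by simp
  ultimately show ?thesis by (metis card_image psubset_card_mono)
qed

text \<open>The image of \<open>P\<close> is the neighbourhood of the image of the hub, so it lies entirely in one of the two
  sides. If it lay in \<open>E\<close>, then, as every vertex of \<open>E\<close> has a neighbour in \<open>P\<close>, the other side would be
  mapped injectively into \<open>P\<close>, which is too small.\<close>

lemma Aut_image_P: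
  assumes f: "f \<in> carrier (Aut G)"
  shows "f ` P = P"
proof -
  have inj: "inj_on f (pverts G)" using f by (simp add: carrier_Aut Bij_inj_on)
  have fu: "neighbours G (f u) = f ` P"
    using neighbours_Aut[OF f E_verts[OF hub(1)]] hub(2) by simp
  have "f u \<notin> P"
  proof
    assume "f u \<in> P"
    then have PE: "f ` P \<subseteq> E" using fu neighbours_P by blast
    have "f ` E \<subseteq> P"
    proof
      fix y assume "y \<in> f ` E"
      then obtain e where e: "e \<in> E" "y = f e" by blast
      obtain p where p: "p \<in> neighbours G e" using neighbours_E_nonempty[OF e(1)] by blast
      have "f p \<in> neighbours G (f e)" using neighbours_Aut[OF f E_verts[OF e(1)]] p by blast
      moreover have "f p \<in> E" using p neighbours_E[OF e(1)] PE by blast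
      ultimately show "y \<in> P"
        using neighbours_sym[of "f p" "f e"] Aut_mem[OF f E_verts[OF e(1)]] neighbours_E e(2)
        by blast
    qed
    moreover have "inj_on f E" using inj sides by (auto intro: inj_on_subset)
    moreover have "finite P" using fin sides by simp
    ultimately have "card E \<le> card P" by (metis card_inj_on_le)
    then show False using card_P_less_card_E by simp
  qed
  then have "f u \<in> E" using Aut_mem[OF f E_verts[OF hub(1)]] sides by blast
  then have "f ` P \<subseteq> P" using fu neighbours_E by blast
  moreover have "inj_on f P" using inj sides by (auto intro: inj_on_subset)
  moreover have "finite P" using fin sides by simp
  ultimately show ?thesis by (simp add: endo_inj_surj)
qed

lemma Aut_P: "f \<in> carrier (Aut G) \<Longrightarrow> p \<in> P \<Longrightarrow> f p \<in> P"
  using Aut_image_P by blast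

lemma Aut_E:
  assumes f: "f \<in> carrier (Aut G)" and e: "e \<in> E"
  shows "f e \<in> E"
proof -
  have "f e \<notin> f ` P"
    using f e sides by (auto simp: carrier_Aut dest!: Bij_inj_on inj_onD)
  then show ?thesis
    using Aut_image_P[OF f] Aut_mem[OF f E_verts[OF e]] sides by blast
qed

text \<open>For a single neighbourhood, any permutation of \<open>P\<close> can be imitated by an automorphism: the full set
  \<open>P\<close> is invariant under both, and a set of at most two points is moved anywhere by double
  transitivity.\<close>

lemma Aut_neighbourhood_image:
  assumes \<pi>: "\<pi> \<in> Bij P" and e: "e \<in> E"
  shows "\<exists>g\<in>carrier (Aut G). g ` neighbours G e = \<pi> ` neighbours G e"
proof (cases "neighbours G e = P")
  case True
  have "(\<lambda>x\<in>pverts G. x) \<in> carrier (Aut G)" by (simp add: carrier_Aut id_Bij)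
  then show ?thesis using True Aut_image_P Bij_image[OF \<pi>] by metis
next
  case False
  then obtain p p' where p: "p \<in> P" "p' \<in> P" "neighbours G e = {p, p'}"
    using neighbourhoods[OF e] by blast
  show ?thesis
  proof (cases "p = p'")
    case True
    then show ?thesis using transitive[OF p(1) Bij_mem[OF \<pi> p(1)]] p(3) by auto
  next
    case False
    then have "\<pi> p \<noteq> \<pi> p'" using Bij_inj_on[OF \<pi>] p by (meson inj_onD)
    then show ?thesis
      using two_transitive[OF p(1,2) False Bij_mem[OF \<pi> p(1)] Bij_mem[OF \<pi> p(2)]] p(3) by auto
  qed
qed

text \<open>For every neighbourhood \<open>S\<close> choose an automorphism \<open>g S\<close> that maps \<open>S\<close> to \<open>\<pi> ` S\<close>. It then maps the
  vertices with neighbourhood \<open>S\<close> to vertices with neighbourhood \<open>\<pi> ` S\<close>, and that is all that an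
  extension of \<open>\<pi>\<close> must do. Hence the pieces, one for each twin class, glue to an automorphism,
  although different pieces come from unrelated automorphisms.\<close>

lemma extend_to_Aut:
  assumes \<pi>: "\<pi> \<in> Bij P"
  shows "\<exists>f\<in>carrier (Aut G). restrict f P = \<pi>"
proof -
  have "\<forall>S\<in>neighbours G ` E. \<exists>g. g \<in> carrier (Aut G) \<and> g ` S = \<pi> ` S"
    using Aut_neighbourhood_image[OF \<pi>] by blast
  then obtain g where g: "g S \<in> carrier (Aut G)" "g S ` S = \<pi> ` S" if "S \<in> neighbours G ` E" for S
    by metis
  define f where "f = (\<lambda>x\<in>pverts G. if x \<in> P then \<pi> x else g (neighbours G x) x)"
  have fP: "f p = \<pi> p" if "p \<in> P" for p using that by (simp add: f_def P_verts)
  have fE: "f e = g (neighbours G e) e" if "e \<in> E" for e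
    using that sides by (auto simp: f_def)
  have f_in_P: "f p \<in> P" if "p \<in> P" for p using that fP Bij_mem[OF \<pi>] by simp
  have f_in_E: "f e \<in> E" if "e \<in> E" for e using that fE Aut_E g(1) by simp
  have N: "neighbours G (f e) = \<pi> ` neighbours G e" if "e \<in> E" for e
    using that fE[OF that] neighbours_Aut[OF g(1) E_verts, of "neighbours G e" e] g(2)[of "neighbours G e"]
    by simp
  have "inj_on f (pverts G)"
  proof (rule inj_onI)
    fix x y assume xy: "x \<in> pverts G" "y \<in> pverts G" "f x = f y"
    then consider "x \<in> P" "y \<in> P" | "x \<in> E" "y \<in> E"
      using f_in_P f_in_E sides by (metis Un_iff disjoint_iff)
    then show "x = y"
    proof cases
      case 1
      then show ?thesis using xy fP Bij_inj_on[OF \<pi>] by (metis inj_onD)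
    next
      case 2
      then have "\<pi> ` neighbours G x = \<pi> ` neighbours G y" using N xy by metis
      then have "neighbours G x = neighbours G y"
        using inj_on_image_eq_iff[OF Bij_inj_on[OF \<pi>]] neighbours_E 2 by blast
      then have "g (neighbours G x) x = g (neighbours G x) y" using xy fE 2 by metis
      then show ?thesis
        using g(1)[of "neighbours G x"] xy 2 by (auto simp: carrier_Aut dest!: Bij_inj_on inj_onD)
    qed
  qed
  moreover have "f ` pverts G \<subseteq> pverts G" using f_in_P f_in_E sides by auto
  ultimately have "bij_betw f (pverts G) (pverts G)"
    using endo_inj_surj[OF fin] by (simp add: bij_betw_def)
  moreover have "f \<in> extensional (pverts G)" by (simp add: f_def)
  ultimately have fB: "f \<in> Bij (pverts G)" by (simp add: Bij_def)
  have EP: "(f e, f p) \<in> parcs G \<longleftrightarrow> (e, p) \<in> parcs G" if "e \<in> E" "p \<in> P" for e p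
  proof -
    have "(f e, f p) \<in> parcs G \<longleftrightarrow> \<pi> p \<in> \<pi> ` neighbours G e"
      using N[OF that(1)] fP[OF that(2)] P_verts[OF f_in_P[OF that(2)]] by (auto simp: neighbours_def)
    also have "\<dots> \<longleftrightarrow> p \<in> neighbours G e"
      using inj_on_image_mem_iff[OF Bij_inj_on[OF \<pi>] that(2) neighbours_E[OF that(1)]] .
    finally show ?thesis using P_verts[OF that(2)] by (simp add: neighbours_def)
  qed
  have "f \<in> carrier (Aut G)"
    unfolding carrier_Aut
  proof (intro conjI fB ballI)
    fix x y assume xy: "x \<in> pverts G" "y \<in> pverts G"
    then consider "x \<in> E" "y \<in> P" | "x \<in> P" "y \<in> E" | "x \<in> E" "y \<in> E" | "x \<in> P" "y \<in> P"
      using sides by blast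
    then show "(f x, f y) \<in> parcs G \<longleftrightarrow> (x, y) \<in> parcs G"
    proof cases
      case 1
      then show ?thesis by (rule EP)
    next
      case 2
      then show ?thesis using EP arcs(2) by (meson symD)
    next
      case 3
      then show ?thesis using f_in_E arcs(1) sides by blast
    next
      case 4
      then show ?thesis using f_in_P arcs(1) sides by blast
    qed
  qed
  moreover have "restrict f P = \<pi>"
    using fP \<pi> by (auto intro: extensionalityI simp: Bij_imp_extensional)
  ultimately show ?thesis by blast
qed

lemma restrict_epi: "(\<lambda>\<phi>. restrict \<phi> P) \<in> epi (Aut G) (BijGroup P)"
proof -
  have res: "restrict f P \<in> Bij P" if "f \<in> carrier (Aut G)" for f
    using that Aut_image_P sides by (auto simp: carrier_Aut intro: restrict_Bij)
  have "(\<lambda>\<phi>. restrict \<phi> P) \<in> hom (Aut G) (BijGroup P)"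
  proof (rule homI)
    fix f g assume fg: "f \<in> carrier (Aut G)" "g \<in> carrier (Aut G)"
    show "restrict (f \<otimes>\<^bsub>Aut G\<^esub> g) P = restrict f P \<otimes>\<^bsub>BijGroup P\<^esub> restrict g P"
      using fg by (auto simp: mult_Aut mult_BijGroup res compose_def Aut_P P_verts fun_eq_iff)
  qed (simp add: res carrier_BijGroup)
  moreover have "(\<lambda>\<phi>. restrict \<phi> P) ` carrier (Aut G) = Bij P"
    using res extend_to_Aut by blast
  ultimately show ?thesis by (simp add: epi_def carrier_BijGroup)
qed

text \<open>No vertex of \<open>P\<close> is a twin of a vertex of \<open>E\<close>: neighbourhoods of the former lie in \<open>E\<close>, those of
  the latter are nonempty subsets of \<open>P\<close>.\<close>

lemma twin_class_E:
  assumes "e \<in> E"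
  shows "twin_rel G `` {e} \<in> twin_classes_in G E"
proof -
  have "x \<in> E" if "(e, x) \<in> twin_rel G" for x
    using that assms neighbours_E_nonempty[OF assms] neighbours_E[OF assms] neighbours_P sides
    unfolding twin_rel_def by blast
  then show ?thesis
    using assms by (auto simp: twin_classes_in_def sides intro: quotientI)
qed

lemma twin_class_P: "p \<in> P \<Longrightarrow> twin_rel G `` {p} \<notin> twin_classes_in G E"
  using self_mem_twin_class[of p G] sides by (auto simp: twin_classes_in_def)

text \<open>An automorphism that fixes \<open>P\<close> pointwise fixes the neighbourhood of every vertex of \<open>E\<close>, so it maps
  each twin class in \<open>E\<close> to itself; its restrictions to these classes are the components of the
  family.\<close>

lemma twin_perm_image_eq_kernel:
  "twin_perm G E ` carrier (product_group (twin_classes_in G E) BijGroup) =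
    kernel (Aut G) (BijGroup P) (\<lambda>\<phi>. restrict \<phi> P)"
proof (intro equalityI subsetI)
  fix f assume "f \<in> twin_perm G E ` carrier (product_group (twin_classes_in G E) BijGroup)"
  then obtain \<sigma> where \<sigma>: "\<sigma> \<in> carrier (product_group (twin_classes_in G E) BijGroup)"
    and f: "f = twin_perm G E \<sigma>" by blast
  have "restrict f P = (\<lambda>p\<in>P. p)"
    unfolding f by (rule restrict_ext) (simp add: twin_perm_outside twin_class_P P_verts)
  then show "f \<in> kernel (Aut G) (BijGroup P) (\<lambda>\<phi>. restrict \<phi> P)"
    using twin_perm_Aut[OF arcs(2) \<sigma>] f by (simp add: kernel_def BijGroup_def)
next
  fix f assume "f \<in> kernel (Aut G) (BijGroup P) (\<lambda>\<phi>. restrict \<phi> P)"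
  then have f: "f \<in> carrier (Aut G)" and "restrict f P = (\<lambda>p\<in>P. p)"
    by (simp_all add: kernel_def BijGroup_def)
  then have fixP: "f p = p" if "p \<in> P" for p using that by (metis restrict_apply')
  have fB: "f \<in> Bij (pverts G)" using f by (simp add: carrier_Aut)
  have N: "neighbours G (f e) = neighbours G e" if "e \<in> E" for e
    using neighbours_Aut[OF f E_verts[OF that]] neighbours_E[OF that] fixP by force
  have res: "restrict f C \<in> Bij C" if C: "C \<in> twin_classes_in G E" for C
  proof -
    have CE: "C \<subseteq> E" and CV: "C \<subseteq> pverts G"
      using C twin_classes_in_subset[OF C] by (auto simp: twin_classes_in_def)
    have "f ` C \<subseteq> C"
    proof (intro image_subsetI)
      fix x assume x: "x \<in> C"
      then have "(x, f x) \<in> twin_rel G"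
        using N CE CV Aut_mem[OF f] by (auto simp: twin_rel_def)
      then show "f x \<in> C" using twin_class_eq[OF C x] by blast
    qed
    moreover have "inj_on f C" using Bij_inj_on[OF fB] CV by (rule inj_on_subset)
    moreover have "finite C" using fin CV by (rule rev_finite_subset)
    ultimately show ?thesis using restrict_Bij[OF fB CV] by (simp add: endo_inj_surj)
  qed
  define \<sigma> where "\<sigma> = (\<lambda>C\<in>twin_classes_in G E. restrict f C)"
  have \<sigma>: "\<sigma> \<in> carrier (product_group (twin_classes_in G E) BijGroup)"
    using res by (simp add: \<sigma>_def carrier_BijGroup)
  have "f = twin_perm G E \<sigma>"
  proof (rule Bij_eqI[OF fB twin_perm_Bij[OF \<sigma>]])
    fix x assume x: "x \<in> pverts G"
    then consider "x \<in> E" | "x \<in> P" using sides by blast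
    then show "f x = twin_perm G E \<sigma> x"
    proof cases
      case 1
      then show ?thesis
        using twin_perm_inside[OF twin_class_E[OF 1] self_mem_twin_class[OF x]]
          twin_class_E[OF 1] self_mem_twin_class[OF x]
        by (simp add: \<sigma>_def)
    next
      case 2
      then show ?thesis using twin_perm_outside[OF x twin_class_P[OF 2]] fixP by simp
    qed
  qed
  then show "f \<in> twin_perm G E ` carrier (product_group (twin_classes_in G E) BijGroup)"
    using \<sigma> by blast
qed

theorem Aut_structure:
  "(\<lambda>\<phi>. restrict \<phi> P) \<in> epi (Aut G) (BijGroup P) \<and>
    twin_perm G E \<in> mon (product_group (twin_classes_in G E) BijGroup) (Aut G) \<and>
    twin_perm G E ` carrier (product_group (twin_classes_in G E) BijGroup) \<lhd> Aut G \<and>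
    Aut G Mod (twin_perm G E ` carrier (product_group (twin_classes_in G E) BijGroup))
      \<cong> sym_group (card P)"
proof -
  interpret group_hom "Aut G" "BijGroup P" "\<lambda>\<phi>. restrict \<phi> P"
    using restrict_epi group_Aut[of G] group_BijGroup[of P]
    unfolding group_hom_def group_hom_axioms_def epi_def by blast
  have "Aut G Mod kernel (Aut G) (BijGroup P) (\<lambda>\<phi>. restrict \<phi> P) \<cong> BijGroup P"
    using FactGroup_iso restrict_epi by (simp add: epi_def)
  also have "BijGroup P \<cong> sym_group (card P)"
    using fin sides by (intro BijGroup_iso_sym_group) simp
  finally show ?thesis
    using restrict_epi twin_perm_mon[OF arcs(2)] normal_kernel
    by (simp add: twin_perm_image_eq_kernel del: carrier_product_group)
qed

end

section \<open>Vectors and matrices of size two\<close>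

definition vec2 :: "'a \<Rightarrow> 'a \<Rightarrow> 'a vec" where
  "vec2 x y = vec 2 (\<lambda>i. if i = 0 then x else y)"

definition mat2 :: "'a \<Rightarrow> 'a \<Rightarrow> 'a \<Rightarrow> 'a \<Rightarrow> 'a mat" where
  "mat2 a b c d = mat 2 2 (\<lambda>(i, j). if i = 0 then if j = 0 then a else b else if j = 0 then c else d)"

lemma vec2_carrier [simp]: "vec2 x y \<in> carrier_vec 2"
  and mat2_carrier [simp]: "mat2 a b c d \<in> carrier_mat 2 2"
  by (simp_all add: vec2_def mat2_def)

lemma vec2_eq_iff [simp]: "vec2 x y = vec2 x' y' \<longleftrightarrow> x = x' \<and> y = y'"
proof
  assume eq: "vec2 x y = vec2 x' y'"
  have "vec2 x y $ 0 = vec2 x' y' $ 0" "vec2 x y $ 1 = vec2 x' y' $ 1" using eq by simp_all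
  then show "x = x' \<and> y = y'" by (simp add: vec2_def)
qed simp

lemma mat2_eq_iff [simp]:
  "mat2 a b c d = mat2 a' b' c' d' \<longleftrightarrow> a = a' \<and> b = b' \<and> c = c' \<and> d = d'"
proof
  assume eq: "mat2 a b c d = mat2 a' b' c' d'"
  have "mat2 a b c d $$ (i, j) = mat2 a' b' c' d' $$ (i, j)" for i j using eq by simp
  from this[of 0 0] this[of 0 1] this[of 1 0] this[of 1 1]
  show "a = a' \<and> b = b' \<and> c = c' \<and> d = d'" by (simp add: mat2_def)
qed simp

lemma vec2_cases: "v \<in> carrier_vec 2 \<Longrightarrow> \<exists>x y. v = vec2 x y"
  by (intro exI[of _ "v $ 0"] exI[of _ "v $ 1"]) (auto simp: vec2_def less_2_cases_iff)

lemma mat2_cases: "M \<in> carrier_mat 2 2 \<Longrightarrow> \<exists>a b c d. M = mat2 a b c d"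
  by (intro exI[of _ "M $$ (0, 0)"] exI[of _ "M $$ (0, 1)"] exI[of _ "M $$ (1, 0)"]
      exI[of _ "M $$ (1, 1)"]) (auto simp: mat2_def less_2_cases_iff)

lemma zero_vec2: "0\<^sub>v 2 = vec2 0 0"
  by (auto simp: vec2_def)

lemma zero_mat2: "0\<^sub>m 2 2 = mat2 0 0 0 0"
  by (auto simp: mat2_def)

lemma one_mat2: "1\<^sub>m 2 = mat2 1 0 0 1"
  by (auto simp: mat2_def less_2_cases_iff)

lemma smult_vec2 [simp]: "k \<cdot>\<^sub>v vec2 x y = vec2 (k * x) (k * y)"
  by (auto simp: vec2_def)

lemma sum_less_2: "(\<Sum>i = 0..<2. f i) = f 0 + f (1 :: nat)"
  by (simp add: numeral_2_eq_2)

lemma mult_mat2_vec2 [simp]: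
  "mat2 a b c d *\<^sub>v vec2 x y = vec2 (a * x + b * y) (c * x + d * y :: 'a :: comm_semiring_0)"
  by (intro eq_vecI) (auto simp: vec2_def mat2_def scalar_prod_def less_2_cases_iff sum_less_2)

lemma mult_mat2 [simp]:
  "mat2 a b c d * mat2 a' b' c' d' = mat2 (a * a' + b * c') (a * b' + b * d') (c * a' + d * c')
    (c * b' + d * d' :: 'a :: comm_semiring_0)"
  by (intro eq_matI) (auto simp: mat2_def scalar_prod_def less_2_cases_iff sum_less_2)

text \<open>A nonzero \<open>v\<close> is an eigenvector of \<open>M\<close> iff \<open>M v\<close> and \<open>v\<close> are linearly dependent. This eliminates the
  eigenvalue and turns eigenlines into projective zeros of a binary quadratic form.\<close>

lemma is_eigenvector_mat2:
  fixes a :: "'a::field"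
  shows "is_eigenvector (mat2 a b c d) (vec2 x y) \<longleftrightarrow>
    (x \<noteq> 0 \<or> y \<noteq> 0) \<and> (a * x + b * y) * y = (c * x + d * y) * x"
proof -
  have dim: "dim_row (mat2 a b c d) = 2" by (simp add: mat2_def)
  have "(\<exists>k. a * x + b * y = k * x \<and> c * x + d * y = k * y) \<longleftrightarrow>
      (a * x + b * y) * y = (c * x + d * y) * x" if "x \<noteq> 0 \<or> y \<noteq> 0"
  proof
    assume eq: "(a * x + b * y) * y = (c * x + d * y) * x"
    show "\<exists>k. a * x + b * y = k * x \<and> c * x + d * y = k * y"
    proof (cases "x = 0")
      case False
      then show ?thesis using eq
        by (intro exI[of _ "(a * x + b * y) / x"]) (simp add: field_simps)
    next
      case True
      then show ?thesis using eq that
        by (intro exI[of _ "(c * x + d * y) / y"]) (simp add: field_simps)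
    qed
  qed auto
  then show ?thesis
    by (auto simp: is_eigenvector_def eigenvector_def dim zero_vec2)
qed

lemma vec_line_eq_iff:
  fixes x :: "'a::field"
  assumes v: "x \<noteq> 0 \<or> y \<noteq> 0" and v': "x' \<noteq> 0 \<or> y' \<noteq> 0"
  shows "vec_line (vec2 x y) = vec_line (vec2 x' y') \<longleftrightarrow> x * y' = y * x'"
proof
  assume "vec_line (vec2 x y) = vec_line (vec2 x' y')"
  moreover have "vec2 x y \<in> vec_line (vec2 x y)"
    unfolding vec_line_def by (rule range_eqI[of _ _ 1]) simp
  ultimately have "vec2 x y \<in> vec_line (vec2 x' y')" by simp
  then have "\<exists>k. x = k * x' \<and> y = k * y'" by (auto simp: vec_line_def)
  then obtain k where "x = k * x'" "y = k * y'" by blast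
  then show "x * y' = y * x'" by simp
next
  have sub: "vec_line (vec2 s t) \<subseteq> vec_line (vec2 s' t')"
    if "s * t' = t * s'" "s' \<noteq> 0 \<or> t' \<noteq> 0" for s t s' t' :: 'a
  proof -
    have "\<exists>l. s = l * s' \<and> t = l * t'"
    proof (cases "s' = 0")
      case False
      then show ?thesis using that by (intro exI[of _ "s / s'"]) (simp add: field_simps)
    next
      case True
      then show ?thesis using that by (intro exI[of _ "t / t'"]) (simp add: field_simps)
    qed
    then obtain l where l: "s = l * s'" "t = l * t'" by blast
    show ?thesis
      unfolding vec_line_def l
      by (auto intro: range_eqI[of _ _ "_ * l"] simp: mult.assoc)
  qed
  assume "x * y' = y * x'"
  then show "vec_line (vec2 x y) = vec_line (vec2 x' y')"
    using sub[of x y' y x'] sub[of x' y y' x] v v' by (simp add: mult.commute)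
qed

section \<open>The spectral incidence graph of the plane\<close>

lemma P_part_iff:
  "p \<in> P_part TYPE('a::field) \<longleftrightarrow>
    (\<exists>x y. (x \<noteq> 0 \<or> y \<noteq> 0) \<and> p = Inr (vec_line (vec2 x (y :: 'a))))"
  unfolding P_part_def P_lines_def image_image zero_vec2
  by (auto dest!: vec2_cases) force+

lemma P_partI: "x \<noteq> 0 \<or> y \<noteq> 0 \<Longrightarrow> Inr (vec_line (vec2 x y)) \<in> P_part TYPE('a::field)"
  by (auto simp: P_part_iff)

lemma E_part_iff:
  "e \<in> E_part TYPE('a::field) \<longleftrightarrow> (\<exists>M\<in>E2 TYPE('a). e = Inl (mat_line M))"
  by (auto simp: E_part_def E_lines_def)

lemma SIG_verts_iff:
  "x \<in> pverts (SIG TYPE('a::field)) \<longleftrightarrow> (\<exists>M\<in>E2 TYPE('a). x = Inl (mat_line M)) \<or>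
    (\<exists>v\<in>carrier_vec 2. v \<noteq> 0\<^sub>v 2 \<and> x = Inr (vec_line v))"
  by (auto simp: SIG_def E_part_def E_lines_def P_part_def P_lines_def)

lemma spectral_incI:
  "M \<in> E2 TYPE('a::field) \<Longrightarrow> v \<in> carrier_vec 2 \<Longrightarrow> is_eigenvector M v \<Longrightarrow>
    (Inl (mat_line M), Inr (vec_line v)) \<in> spectral_inc TYPE('a)"
  by (auto simp: spectral_inc_def)

lemma spectral_incE:
  assumes "(x, y) \<in> spectral_inc TYPE('a::field)"
  obtains M v where "M \<in> E2 TYPE('a)" "v \<in> carrier_vec 2" "is_eigenvector M v"
    "x = Inl (mat_line M)" "y = Inr (vec_line v)"
  using assms unfolding spectral_inc_def by (elim CollectE exE conjE Pair_inject)

text \<open>The affine points \<open>(1 : t)\<close> and the point \<open>(0 : 1)\<close> at infinity.\<close>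

lemma card_P_part: "card (P_part TYPE('a::{field,finite})) = card (UNIV :: 'a set) + 1"
proof -
  let ?aff = "\<lambda>t :: 'a. Inr (vec_line (vec2 1 t)) :: 'a mat set + 'a vec set"
  let ?inf = "Inr (vec_line (vec2 0 (1 :: 'a))) :: 'a mat set + 'a vec set"
  have "P_part TYPE('a) = insert ?inf (range ?aff)"
  proof (intro equalityI subsetI)
    fix p assume "p \<in> P_part TYPE('a)"
    then obtain x y :: 'a where xy: "x \<noteq> 0 \<or> y \<noteq> 0" "p = Inr (vec_line (vec2 x y))"
      by (auto simp: P_part_iff)
    show "p \<in> insert ?inf (range ?aff)"
    proof (cases "x = 0")
      case True
      then show ?thesis using xy by (simp add: vec_line_eq_iff)
    next
      case False
      then have "p = ?aff (y / x)" using xy by (simp add: vec_line_eq_iff)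
      then show ?thesis by blast
    qed
  qed (auto intro: P_partI)
  moreover have "inj ?aff" by (rule injI) (simp add: vec_line_eq_iff)
  moreover have "?inf \<notin> range ?aff" by (auto simp: vec_line_eq_iff)
  ultimately show ?thesis by (simp add: card_image)
qed

section \<open>The action of the general linear group\<close>

text \<open>The action of an invertible matrix \<open>A\<close> on the vertices: conjugation on lines of matrices and
  multiplication on lines of vectors. The argument \<open>B\<close> stands for the inverse of \<open>A\<close>.\<close>

definition basis_change ::
  "'a::field mat \<Rightarrow> 'a mat \<Rightarrow> 'a mat set + 'a vec set \<Rightarrow> 'a mat set + 'a vec set" where
  "basis_change A B = map_sum (image (\<lambda>M. A * M * B)) (image (\<lambda>v. A *\<^sub>v v))"

context
  fixes A B :: "'a::field mat"
  assumes A: "A \<in> carrier_mat 2 2" and B: "B \<in> carrier_mat 2 2"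
    and BA: "B * A = 1\<^sub>m 2"
begin

lemma conjugate_back:
  assumes M: "M \<in> carrier_mat 2 2"
  shows "B * (A * M * B) * A = M"
proof -
  have "B * (A * M * B) * A = (B * A) * M * (B * A)"
    using A B M by (simp add: assoc_mult_mat[of _ 2 2 _ 2 _ 2] mult_carrier_mat[of _ 2 2 _ 2])
  then show ?thesis using M by (simp add: BA)
qed

lemma mult_mat_zero_vec: "B *\<^sub>v 0\<^sub>v 2 = 0\<^sub>v 2"
  using B by (auto simp: scalar_prod_def)

lemma transform_back: "v \<in> carrier_vec 2 \<Longrightarrow> B *\<^sub>v (A *\<^sub>v v) = v"
  using assoc_mult_mat_vec[OF B A] by (simp add: BA)

lemma is_eigenvector_conjugate:
  assumes M: "M \<in> carrier_mat 2 2" and v: "v \<in> carrier_vec 2" and ev: "is_eigenvector M v"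
  shows "is_eigenvector (A * M * B) (A *\<^sub>v v)"
proof -
  obtain k where k: "v \<noteq> 0\<^sub>v 2" "M *\<^sub>v v = k \<cdot>\<^sub>v v"
    using ev M by (auto simp: is_eigenvector_def eigenvector_def)
  have "A *\<^sub>v v \<noteq> 0\<^sub>v 2"
    using transform_back[OF v] k(1) mult_mat_vec_carrier B by (metis mult_mat_zero_vec)
  moreover have "(A * M * B) *\<^sub>v (A *\<^sub>v v) = A *\<^sub>v (M *\<^sub>v (B *\<^sub>v (A *\<^sub>v v)))"
    using A B M v by (simp add: assoc_mult_mat_vec[of _ 2 2 _ 2] mult_carrier_mat[of _ 2 2 _ 2])
  then have "(A * M * B) *\<^sub>v (A *\<^sub>v v) = k \<cdot>\<^sub>v (A *\<^sub>v v)"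
    using mult_mat_vec[OF A v] by (simp add: transform_back v k(2))
  ultimately have "eigenvector (A * M * B) (A *\<^sub>v v) k"
    using A v by (simp add: eigenvector_def)
  then show ?thesis by (auto simp: is_eigenvector_def)
qed

lemma E2_conjugate:
  assumes "M \<in> E2 TYPE('a)"
  shows "A * M * B \<in> E2 TYPE('a)"
proof -
  have M: "M \<in> carrier_mat 2 2" "M \<noteq> 0\<^sub>m 2 2" using assms by (auto simp: E2_def)
  have "A * M * B \<noteq> 0\<^sub>m 2 2"
    using conjugate_back[OF M(1)] M(2) A B
    by (metis left_mult_zero_mat right_mult_zero_mat)
  moreover obtain v where "v \<in> carrier_vec 2" "is_eigenvector M v"
    using assms by (auto simp: E2_def)
  then have "A *\<^sub>v v \<in> carrier_vec 2" "is_eigenvector (A * M * B) (A *\<^sub>v v)"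
    using is_eigenvector_conjugate[OF M(1)] mult_mat_vec_carrier[OF A] by simp_all
  ultimately show ?thesis using A B by (auto simp: E2_def)
qed

lemma mat_line_conjugate:
  assumes "M \<in> carrier_mat 2 2"
  shows "(\<lambda>M. A * M * B) ` mat_line M = mat_line (A * M * B)"
  unfolding mat_line_def image_image
  using A B assms by (simp add: mult_smult_distrib[of _ 2 2 _ 2] mult_smult_assoc_mat[of _ 2 2 _ 2]
      mult_carrier_mat[of _ 2 2 _ 2])

lemma vec_line_transform:
  assumes "v \<in> carrier_vec 2"
  shows "(\<lambda>v. A *\<^sub>v v) ` vec_line v = vec_line (A *\<^sub>v v)"
  unfolding vec_line_def image_image using mult_mat_vec[OF A assms] by simp

lemma basis_change_inverse:
  assumes "x \<in> pverts (SIG TYPE('a))"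
  shows "basis_change B A (basis_change A B x) = x"
proof -
  have 1: "(\<lambda>N. B * (A * N * B) * A) ` mat_line M = mat_line M" if "M \<in> E2 TYPE('a)" for M
  proof -
    have "mat_line M \<subseteq> carrier_mat 2 2" using that by (auto simp: mat_line_def E2_def)
    then have "(\<lambda>N. B * (A * N * B) * A) ` mat_line M = (\<lambda>N. N) ` mat_line M"
      by (intro image_cong refl conjugate_back) blast
    then show ?thesis by simp
  qed
  have 2: "(\<lambda>w. B *\<^sub>v (A *\<^sub>v w)) ` vec_line v = vec_line v" if "v \<in> carrier_vec 2" for v
  proof -
    have "vec_line v \<subseteq> carrier_vec 2" using that by (auto simp: vec_line_def)
    then have "(\<lambda>w. B *\<^sub>v (A *\<^sub>v w)) ` vec_line v = (\<lambda>w. w) ` vec_line v"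
      by (intro image_cong refl transform_back) blast
    then show ?thesis by simp
  qed
  show ?thesis
    using assms
    by (auto simp: SIG_verts_iff basis_change_def image_image 1 2)
qed

lemma basis_change_verts:
  assumes "x \<in> pverts (SIG TYPE('a))"
  shows "basis_change A B x \<in> pverts (SIG TYPE('a))"
proof -
  consider M where "M \<in> E2 TYPE('a)" "x = Inl (mat_line M)"
    | v where "v \<in> carrier_vec 2" "v \<noteq> 0\<^sub>v 2" "x = Inr (vec_line v)"
    using assms by (auto simp: SIG_verts_iff)
  then show ?thesis
  proof cases
    case 1
    then have "basis_change A B x = Inl (mat_line (A * M * B))"
      by (simp add: basis_change_def mat_line_conjugate E2_def)
    then show ?thesis unfolding SIG_verts_iff using E2_conjugate[OF 1(1)] by blast
  next
    case 2
    then have "basis_change A B x = Inr (vec_line (A *\<^sub>v v))"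
      by (simp add: basis_change_def vec_line_transform)
    moreover have "A *\<^sub>v v \<noteq> 0\<^sub>v 2"
      using transform_back[OF 2(1)] 2(2) mult_mat_zero_vec by metis
    ultimately show ?thesis
      unfolding SIG_verts_iff using mult_mat_vec_carrier[OF A 2(1)] by blast
  qed
qed

lemma basis_change_arcs:
  assumes "(x, y) \<in> parcs (SIG TYPE('a))"
  shows "(basis_change A B x, basis_change A B y) \<in> parcs (SIG TYPE('a))"
proof -
  have inc: "(basis_change A B x, basis_change A B y) \<in> spectral_inc TYPE('a)"
    if xy: "(x, y) \<in> spectral_inc TYPE('a)" for x y
  proof -
    obtain M v where M: "M \<in> E2 TYPE('a)" "v \<in> carrier_vec 2" "is_eigenvector M v"
      and x: "x = Inl (mat_line M)" and y: "y = Inr (vec_line v)"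
      using xy by (rule spectral_incE)
    have Mc: "M \<in> carrier_mat 2 2" using M(1) by (simp add: E2_def)
    have "basis_change A B x = Inl (mat_line (A * M * B))"
      by (simp add: x basis_change_def mat_line_conjugate[OF Mc])
    moreover have "basis_change A B y = Inr (vec_line (A *\<^sub>v v))"
      by (simp add: y basis_change_def vec_line_transform[OF M(2)])
    moreover have "(Inl (mat_line (A * M * B)), Inr (vec_line (A *\<^sub>v v))) \<in> spectral_inc TYPE('a)"
      by (rule spectral_incI[OF E2_conjugate[OF M(1)] mult_mat_vec_carrier[OF A M(2)]
            is_eigenvector_conjugate[OF Mc M(2,3)]])
    ultimately show ?thesis by simp
  qed
  have "parcs (SIG TYPE('a)) = spectral_inc TYPE('a) \<union> (spectral_inc TYPE('a))\<inverse>"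
    by (simp add: SIG_def)
  then show ?thesis using assms inc[of x y] inc[of y x] by auto
qed

end

lemma basis_change_Aut:
  fixes A B :: "'a::field mat"
  assumes A: "A \<in> carrier_mat 2 2" and B: "B \<in> carrier_mat 2 2"
    and AB: "A * B = 1\<^sub>m 2" and BA: "B * A = 1\<^sub>m 2"
  shows "restrict (basis_change A B) (pverts (SIG TYPE('a))) \<in> carrier (Aut (SIG TYPE('a)))"
proof -
  let ?V = "pverts (SIG TYPE('a))"
  have "bij_betw (basis_change A B) ?V ?V"
  proof (rule bij_betw_byWitness[where f' = "basis_change B A"])
    show "\<forall>x\<in>?V. basis_change B A (basis_change A B x) = x"
      using basis_change_inverse[OF A B BA] by blast
    show "\<forall>x\<in>?V. basis_change A B (basis_change B A x) = x"
      using basis_change_inverse[OF B A AB] by blast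
    show "basis_change A B ` ?V \<subseteq> ?V" using basis_change_verts[OF A B BA] by blast
    show "basis_change B A ` ?V \<subseteq> ?V" using basis_change_verts[OF B A AB] by blast
  qed
  moreover have "(basis_change A B x, basis_change A B y) \<in> parcs (SIG TYPE('a)) \<longleftrightarrow>
      (x, y) \<in> parcs (SIG TYPE('a))" if "x \<in> ?V" "y \<in> ?V" for x y
    using basis_change_arcs[OF A B BA, of x y]
      basis_change_arcs[OF B A AB, of "basis_change A B x" "basis_change A B y"]
      basis_change_inverse[OF A B BA that(1)] basis_change_inverse[OF A B BA that(2)]
    by auto
  ultimately show ?thesis by (simp add: carrier_Aut Bij_def)
qed

text \<open>Representatives of two distinct points are the columns of an invertible matrix; its inverse is the
  adjugate divided by the determinant \<open>D\<close>.\<close>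

lemma Aut_standard_points:
  assumes p: "p \<in> P_part TYPE('a::field)" and p': "p' \<in> P_part TYPE('a)" and "p \<noteq> p'"
  shows "\<exists>g\<in>carrier (Aut (SIG TYPE('a))).
    g (Inr (vec_line (vec2 1 0))) = p \<and> g (Inr (vec_line (vec2 0 1))) = p'"
proof -
  obtain x y x' y' :: 'a where xy: "x \<noteq> 0 \<or> y \<noteq> 0" "p = Inr (vec_line (vec2 x y))"
    and xy': "x' \<noteq> 0 \<or> y' \<noteq> 0" "p' = Inr (vec_line (vec2 x' y'))"
    using p p' unfolding P_part_iff by blast
  define D where "D = x * y' - y * x'"
  have D: "D \<noteq> 0" using assms(3) xy xy' by (auto simp: D_def vec_line_eq_iff)
  define A where "A = mat2 x x' y y'"
  define B where "B = mat2 (y' / D) (- x' / D) (- y / D) (x / D)"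
  have car: "A \<in> carrier_mat 2 2" "B \<in> carrier_mat 2 2" by (simp_all add: A_def B_def)
  have "x * y' / D - x' * y / D = 1"
    using D unfolding diff_divide_distrib[symmetric] by (simp add: D_def mult.commute)
  then have inv: "A * B = 1\<^sub>m 2" "B * A = 1\<^sub>m 2"
    by (simp_all add: A_def B_def one_mat2 mult.commute)
  have "Inr (vec_line (vec2 1 0)) \<in> pverts (SIG TYPE('a))"
    "Inr (vec_line (vec2 0 1)) \<in> pverts (SIG TYPE('a))"
    by (simp_all add: SIG_def P_partI)
  then show ?thesis
    by (intro bexI[OF _ basis_change_Aut[OF car inv]])
      (simp add: basis_change_def vec_line_transform[OF car inv(2)] xy(2) xy'(2), simp add: A_def)
qed

lemma Aut_SIG_two_transitive:
  assumes "p \<in> P_part TYPE('a::field)" "p' \<in> P_part TYPE('a)" "p \<noteq> p'"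
    and "r \<in> P_part TYPE('a)" "r' \<in> P_part TYPE('a)" "r \<noteq> r'"
  shows "\<exists>g\<in>carrier (Aut (SIG TYPE('a))). g p = r \<and> g p' = r'"
proof -
  let ?e = "Inr (vec_line (vec2 1 0)) :: 'a mat set + 'a vec set"
  let ?e' = "Inr (vec_line (vec2 0 1)) :: 'a mat set + 'a vec set"
  interpret group "Aut (SIG TYPE('a))" by (rule group_Aut)
  obtain g where g: "g \<in> carrier (Aut (SIG TYPE('a)))" "g ?e = p" "g ?e' = p'"
    using Aut_standard_points[OF assms(1-3)] by blast
  obtain h where h: "h \<in> carrier (Aut (SIG TYPE('a)))" "h ?e = r" "h ?e' = r'"
    using Aut_standard_points[OF assms(4-6)] by blast
  define f where "f = h \<otimes>\<^bsub>Aut (SIG TYPE('a))\<^esub> inv\<^bsub>Aut (SIG TYPE('a))\<^esub> g"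
  have f: "f \<in> carrier (Aut (SIG TYPE('a)))" using g h by (simp add: f_def)
  have "f \<otimes>\<^bsub>Aut (SIG TYPE('a))\<^esub> g = h" using g h by (simp add: f_def m_assoc)
  then have fg: "compose (pverts (SIG TYPE('a))) f g = h" using mult_Aut[OF f g(1)] by simp
  have "?e \<in> pverts (SIG TYPE('a))" "?e' \<in> pverts (SIG TYPE('a))"
    by (simp_all add: SIG_def P_partI)
  then have "f p = r" "f p' = r'"
    using fun_cong[OF fg, of ?e] fun_cong[OF fg, of ?e'] g h by (simp_all add: compose_eq)
  then show ?thesis using f by blast
qed

section \<open>Eigenlines of a matrix\<close>

lemma neighbours_SIG:
  assumes "M \<in> E2 TYPE('a::field)"
  shows "neighbours (SIG TYPE('a)) (Inl (mat_line M)) =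
    {Inr (vec_line (vec2 x y)) | x y. is_eigenvector M (vec2 x y)}"
proof -
  have nz: "x \<noteq> 0 \<or> y \<noteq> 0" if "is_eigenvector M (vec2 x y)" for x y
    using that assms by (auto simp: is_eigenvector_def eigenvector_def E2_def zero_vec2)
  have adj: "(Inl (mat_line M), Inr (vec_line (vec2 x y))) \<in> parcs (SIG TYPE('a)) \<longleftrightarrow>
      is_eigenvector M (vec2 x y)" if "x \<noteq> 0 \<or> y \<noteq> 0" for x y
    using SIG_adjacent_iff[OF assms, of "vec2 x y"] that by (simp add: zero_vec2)
  show ?thesis
  proof (intro equalityI subsetI)
    fix p :: "'a mat set + 'a vec set"
    assume p: "p \<in> neighbours (SIG TYPE('a)) (Inl (mat_line M))"
    then have "p \<in> P_part TYPE('a)"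
      by (auto simp: neighbours_def SIG_def spectral_inc_def E_part_def)
    then show "p \<in> {Inr (vec_line (vec2 x y)) | x y. is_eigenvector M (vec2 x y)}"
      using p adj by (auto simp: P_part_iff neighbours_def)
  next
    fix p :: "'a mat set + 'a vec set"
    assume "p \<in> {Inr (vec_line (vec2 x y)) | x y. is_eigenvector M (vec2 x y)}"
    then obtain x y where xy: "p = Inr (vec_line (vec2 x y))" "is_eigenvector M (vec2 x y)" by blast
    then have "p \<in> pverts (SIG TYPE('a))" using nz by (auto simp: SIG_def P_part_iff)
    then show "p \<in> neighbours (SIG TYPE('a)) (Inl (mat_line M))"
      using xy adj[of x y] nz[of x y] by (simp add: neighbours_def)
  qed
qed

text \<open>A nonzero binary quadratic form has at most two projective zeros. Explicitly, the
  three hypotheses \<open>Q\<close> are linear equations in \<open>b\<close>, \<open>a - d\<close> and \<open>- c\<close>, and their determinant is, up to sign,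
  of Vandermonde type: the product of the three \<open>2 \<times> 2\<close> determinants of pairs of zeros.\<close>

lemma three_eigenlines:
  fixes a :: "'a::field"
  assumes Q: "(a * x + b * y) * y = (c * x + d * y) * x" "(a * x' + b * y') * y' = (c * x' + d * y') * x'"
    "(a * x'' + b * y'') * y'' = (c * x'' + d * y'') * x''"
    and D: "x * y' \<noteq> y * x'" "x * y'' \<noteq> y * x''" "x' * y'' \<noteq> y' * x''"
  shows "b = 0" "c = 0" "a = d"
proof -
  define q q' q'' where "q = (a * x + b * y) * y - (c * x + d * y) * x"
    and "q' = (a * x' + b * y') * y' - (c * x' + d * y') * x'"
    and "q'' = (a * x'' + b * y'') * y'' - (c * x'' + d * y'') * x''"
  define r r' r'' where "r = x' * y'' - y' * x''" and "r' = x * y'' - y * x''"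
    and "r'' = x * y' - y * x'"
  have q: "q = 0" "q' = 0" "q'' = 0" using Q by (simp_all add: q_def q'_def q''_def)
  have r: "r \<noteq> 0" "r' \<noteq> 0" "r'' \<noteq> 0" using D by (simp_all add: r_def r'_def r''_def)
  \<comment> \<open>Cramer's rule: the coefficients of \<open>q\<close>, \<open>q'\<close>, \<open>q''\<close> are, up to sign, the cofactors of the linear system.\<close>
  have "b * (r * r' * r'') = q * (x' * x'' * r) - q' * (x * x'' * r') + q'' * (x * x' * r'')"
    unfolding q_def q'_def q''_def r_def r'_def r''_def by (simp add: algebra_simps)
  moreover have "c * (r * r' * r'') = - (q * (y' * y'' * r) - q' * (y * y'' * r') + q'' * (y * y' * r''))"
    unfolding q_def q'_def q''_def r_def r'_def r''_def by (simp add: algebra_simps)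
  moreover have "(a - d) * (r * r' * r'') = - (q * ((x' * y'' + y' * x'') * r) -
      q' * ((x * y'' + y * x'') * r') + q'' * ((x * y' + y * x') * r''))"
    unfolding q_def q'_def q''_def r_def r'_def r''_def by (simp add: algebra_simps)
  ultimately show "b = 0" "c = 0" "a = d" using q r by auto
qed

text \<open>A matrix with three eigenlines is scalar, and every line is an eigenline of a scalar matrix.\<close>

lemma neighbours_SIG_cases:
  assumes e: "e \<in> E_part TYPE('a::field)"
  shows "neighbours (SIG TYPE('a)) e = P_part TYPE('a) \<or>
    (\<exists>p\<in>P_part TYPE('a). \<exists>p'\<in>P_part TYPE('a). neighbours (SIG TYPE('a)) e = {p, p'})"
proof -
  let ?N = "neighbours (SIG TYPE('a)) e" and ?P = "P_part TYPE('a)"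
  obtain M where M: "M \<in> E2 TYPE('a)" "e = Inl (mat_line M)" using e unfolding E_part_iff by blast
  obtain a b c d where M2: "M = mat2 a b c d" using M(1) mat2_cases unfolding E2_def by blast
  obtain v where v: "v \<in> carrier_vec 2" "is_eigenvector M v" using M(1) unfolding E2_def by blast
  have N: "?N = {Inr (vec_line (vec2 x y)) | x y. (x \<noteq> 0 \<or> y \<noteq> 0) \<and>
      (a * x + b * y) * y = (c * x + d * y) * x}"
    using neighbours_SIG[OF M(1)] by (simp add: M(2)) (simp add: M2 is_eigenvector_mat2)
  have sub: "?N \<subseteq> ?P" unfolding N by (auto intro: P_partI)
  obtain p where p: "p \<in> ?N"
    using v vec2_cases[OF v(1)] neighbours_SIG[OF M(1)] M(2) by blast
  show ?thesis
  proof (cases "\<exists>p'\<in>?N. \<exists>p''\<in>?N. p \<noteq> p' \<and> p \<noteq> p'' \<and> p' \<noteq> p''")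
    case False
    obtain p' where p': "p' \<in> ?N" "?N \<subseteq> {p, p'}"
    proof (cases "?N \<subseteq> {p}")
      case True
      then show ?thesis using that[of p] p by blast
    next
      case notsub: False
      then obtain p' where "p' \<in> ?N" "p \<noteq> p'" by blast
      moreover have "s \<in> {p, p'}" if "s \<in> ?N" for s
      proof (rule ccontr)
        assume "s \<notin> {p, p'}"
        then have "p \<noteq> s" "p' \<noteq> s" by auto
        then show False using False \<open>p' \<in> ?N\<close> \<open>p \<noteq> p'\<close> that by metis
      qed
      ultimately show ?thesis using that[of p'] by auto
    qed
    then have "?N = {p, p'}" using p by blast
    then show ?thesis using p p'(1) sub by blast
  next
    case True
    then obtain p' p'' where pp: "p' \<in> ?N" "p'' \<in> ?N" "p \<noteq> p'" "p \<noteq> p''" "p' \<noteq> p''" by blast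
    obtain x y where 1: "p = Inr (vec_line (vec2 x y))" "x \<noteq> 0 \<or> y \<noteq> 0"
      "(a * x + b * y) * y = (c * x + d * y) * x" using p N by blast
    obtain x' y' where 2: "p' = Inr (vec_line (vec2 x' y'))" "x' \<noteq> 0 \<or> y' \<noteq> 0"
      "(a * x' + b * y') * y' = (c * x' + d * y') * x'" using pp(1) N by blast
    obtain x'' y'' where 3: "p'' = Inr (vec_line (vec2 x'' y''))" "x'' \<noteq> 0 \<or> y'' \<noteq> 0"
      "(a * x'' + b * y'') * y'' = (c * x'' + d * y'') * x''" using pp(2) N by blast
    have "b = 0" "c = 0" "a = d"
      using three_eigenlines[OF 1(3) 2(3) 3(3)] pp(3-5) 1 2 3 by (simp_all add: vec_line_eq_iff)
    have "?P \<subseteq> ?N"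
    proof
      fix r assume "r \<in> ?P"
      then obtain s t where "s \<noteq> 0 \<or> t \<noteq> 0" "r = Inr (vec_line (vec2 s t))"
        unfolding P_part_iff by blast
      then show "r \<in> ?N"
        unfolding N mem_Collect_eq using \<open>b = 0\<close> \<open>c = 0\<close> \<open>a = d\<close>
        by (intro exI[of _ s] exI[of _ t]) simp
    qed
    then show ?thesis using sub by blast
  qed
qed

text \<open>The hub is the line of the identity matrix. As leaf serves the nilpotent matrix \<open>mat2 0 1 0 0\<close>,
  whose only eigenline is spanned by the first basis vector.\<close>

lemma two_transitive_bipartite_SIG:
  "two_transitive_bipartite (SIG TYPE('a::{field,finite})) (E_part TYPE('a)) (P_part TYPE('a))
    (Inl (mat_line (1\<^sub>m 2)))"
proof -
  let ?G = "SIG TYPE('a)" and ?E = "E_part TYPE('a)" and ?P = "P_part TYPE('a)"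
  interpret pair_graph ?G by (rule pair_graph_SIG)
  have E2I: "mat2 a b c d \<in> E2 TYPE('a)"
    if "is_eigenvector (mat2 a b c d) (vec2 x y)" "mat2 a b c d \<noteq> mat2 0 0 0 0" for a b c d x y :: 'a
    using that by (auto simp: E2_def zero_mat2 intro: bexI[of _ "vec2 x y"])
  have I: "mat2 1 0 0 1 \<in> E2 TYPE('a)"
    by (rule E2I[of _ _ _ _ 1 0]) (simp_all add: is_eigenvector_mat2)
  have nil: "mat2 0 1 0 0 \<in> E2 TYPE('a)"
    by (rule E2I[of _ _ _ _ 1 0]) (simp_all add: is_eigenvector_mat2)
  show ?thesis
  proof
    show "finite (pverts ?G)" by simp
    show "pverts ?G = ?E \<union> ?P" by (simp add: SIG_def)
    show "?E \<inter> ?P = {}" by (auto simp: E_part_def P_part_def)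
    show "parcs ?G \<subseteq> ?E \<times> ?P \<union> ?P \<times> ?E"
    proof -
      have "(x, y) \<in> ?E \<times> ?P" if xy: "(x, y) \<in> spectral_inc TYPE('a)" for x y
      proof -
        obtain M v where M: "M \<in> E2 TYPE('a)" "v \<in> carrier_vec 2" "is_eigenvector M v"
          and x: "x = Inl (mat_line M)" and y: "y = Inr (vec_line v)"
          using xy by (rule spectral_incE)
        have "v \<noteq> 0\<^sub>v 2" using M by (auto simp: is_eigenvector_def eigenvector_def E2_def)
        then show ?thesis using M(1,2) by (simp add: x y E_part_def E_lines_def P_part_def P_lines_def)
      qed
      then show ?thesis by (auto simp: SIG_def)
    qed
    show "sym (parcs ?G)" by (simp add: SIG_def sym_Un_converse)
    have "Inr (vec_line (vec2 1 0)) \<in> ?P" "Inr (vec_line (vec2 0 1)) \<in> ?P"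
      by (simp_all add: P_partI)
    moreover have "vec_line (vec2 1 0) \<noteq> vec_line (vec2 0 (1 :: 'a))" by (simp add: vec_line_eq_iff)
    ultimately show "\<exists>p\<in>?P. \<exists>p'\<in>?P. p \<noteq> p'" by (metis Inr_inject)
    show "Inl (mat_line (1\<^sub>m 2)) \<in> ?E" using I by (auto simp: E_part_iff one_mat2)
    show "neighbours ?G (Inl (mat_line (1\<^sub>m 2))) = ?P"
    proof (intro equalityI subsetI)
      fix r assume "r \<in> neighbours ?G (Inl (mat_line (1\<^sub>m 2)))"
      then show "r \<in> ?P"
        unfolding one_mat2 neighbours_SIG[OF I] by (auto simp: is_eigenvector_mat2 intro: P_partI)
    next
      fix r assume "r \<in> ?P"
      then obtain s t where "s \<noteq> 0 \<or> t \<noteq> 0" "r = Inr (vec_line (vec2 s t))"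
        unfolding P_part_iff by blast
      then show "r \<in> neighbours ?G (Inl (mat_line (1\<^sub>m 2)))"
        unfolding one_mat2 neighbours_SIG[OF I] mem_Collect_eq
        by (intro exI[of _ s] exI[of _ t]) (simp add: is_eigenvector_mat2)
    qed
    have "neighbours ?G (Inl (mat_line (mat2 0 1 0 0))) = {Inr (vec_line (vec2 1 0))}"
    proof (intro equalityI subsetI)
      fix r assume "r \<in> neighbours ?G (Inl (mat_line (mat2 0 1 0 0)))"
      then obtain s where "s \<noteq> 0" "r = Inr (vec_line (vec2 s 0))"
        unfolding neighbours_SIG[OF nil] by (auto simp: is_eigenvector_mat2)
      then show "r \<in> {Inr (vec_line (vec2 1 0))}"
        using vec_line_eq_iff[of s 0 1 0] by simp
    next
      fix r :: "'a mat set + 'a vec set" assume "r \<in> {Inr (vec_line (vec2 1 0))}"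
      then show "r \<in> neighbours ?G (Inl (mat_line (mat2 0 1 0 0)))"
        unfolding neighbours_SIG[OF nil] mem_Collect_eq
        by (intro exI[of _ 1] exI[of _ 0]) (simp add: is_eigenvector_mat2)
    qed
    moreover have "Inl (mat_line (mat2 0 1 0 0)) \<in> ?E" using nil by (simp add: E_part_def E_lines_def)
    moreover have "Inr (vec_line (vec2 1 0)) \<in> ?P" by (simp add: P_partI)
    ultimately show "\<exists>e\<in>?E. \<exists>p\<in>?P. neighbours ?G e = {p}" by (intro bexI)
  qed (erule neighbours_SIG_cases, rule Aut_SIG_two_transitive)
qed

section \<open>The automorphism group of the spectral incidence graph\<close>

theorem lemma3p18:
  fixes q :: nat
  assumes "primepow q" and "card (UNIV :: 'a::{field,finite} set) = q"
  defines "G \<equiv> SIG TYPE('a)" and "E \<equiv> E_part TYPE('a)" and "P \<equiv> P_part TYPE('a)"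
  shows "(\<lambda>\<phi>. restrict \<phi> P) \<in> epi (Aut G) (BijGroup P) \<and>
    twin_perm G E \<in> mon (product_group (twin_classes_in G E) BijGroup) (Aut G) \<and>
    twin_perm G E ` carrier (product_group (twin_classes_in G E) BijGroup) \<lhd> Aut G \<and>
    Aut G Mod (twin_perm G E ` carrier (product_group (twin_classes_in G E) BijGroup))
      \<cong> sym_group (q + 1)"
proof -
  interpret two_transitive_bipartite G E P "Inl (mat_line (1\<^sub>m 2))"
    unfolding G_def E_def P_def by (rule two_transitive_bipartite_SIG)
  have "card P = q + 1" using assms(2) by (simp add: P_def card_P_part)
  then show ?thesis using Aut_structure by simp
qed

end
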